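(* For any even integer $p\ge12$, $$\mathcal{M}^{\mathrm{EM}}_p(\mathcal{S}_p\cap\mathbb{C}_{-,0})<\frac{3.423^p}{\pi\sqrt{p-1}}.$$
   Context: Explicit midpoint (EM) extrapolation of even order $p\ge2$, $r=p/2$, on the test equation $U'=\lambda U$, with $z=\tau\lambda\in\mathbb{C}$ and internal perturbations: given $U_n$ and residuals $\tilde r_{m,j}\in\mathbb{C}$ ($1\le m\le r$, $1\le j\le2m$), set $$\widetilde Y_{m,0}=U_n,\quad \widetilde Y_{m,1}=\Big(1+\frac z{2m}\Big)\widetilde Y_{m,0}+\tilde r_{m,1},\quad \widetilde Y_{m,j}=\widetilde Y_{m,j-2}+\frac zm\widetilde Y_{m,j-1}+\tilde r_{m,j}\ (2\le j\le2m),\quad T_{m,1}=\widetilde Y_{m,2m},$$ $$T_{j,k}=T_{j,k-1}+\frac{T_{j,k-1}-T_{j-1,k-1}}{\frac{j^2}{(j-k+1)^2}-1}\quad(2\le k\le j\le r),\qquad U_{n+1}=T_{r,r}.$$ Then $U_{n+1}=P(z)U_n+\sum_{m=1}^r\sum_{\ell=1}^{2m}Q^{\mathrm{EM}}_{p,m,\ell}(z)\,\tilde r_{m,\ell}$, which defines the internal stability polynomials $Q^{\mathrm{EM}}_{p,m,\ell}$. For $\mathcal{S}\subset\mathbb{C}$, $$\mathcal{M}^{\mathrm{EM}}_p(\mathcal{S}):=\max_{1\le m\le r}\max_{1\le\ell\le2m}\sup_{z\in\mathcal{S}}|Q^{\mathrm{EM}}_{p,m,\ell}(z)|.$$ The absolute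 stability region of the method is $\mathcal{S}_p=\{z\in\mathbb{C}:|\sum_{k=0}^pz^k/k!|\le1\}$, and $\mathbb{C}_{-,0}=\{z\in\mathbb{C}:\operatorname{Re}z\le0\}$. *)

theory Defs
  imports Complex_Main "HOL-Library.Extended_Real" "HOL-Computational_Algebra.Polynomial"
begin

text \<open>
  One step of explicit midpoint extrapolation for \<open>U' = \<lambda> U\<close>, with \<open>z = \<tau> \<lambda>\<close>,
  starting value \<open>U\<close> and residuals \<open>\<rho> m j\<close>.
\<close>

fun em_Y :: "complex \<Rightarrow> complex \<Rightarrow> (nat \<Rightarrow> nat \<Rightarrow> complex) \<Rightarrow> nat \<Rightarrow> nat \<Rightarrow> complex" where
  "em_Y z U \<rho> m 0 = U"
| "em_Y z U \<rho> m (Suc 0) = (1 + z / (2 * of_nat m)) * em_Y z U \<rho> m 0 + \<rho> m 1"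
| "em_Y z U \<rho> m (Suc (Suc j)) =
     em_Y z U \<rho> m j + z / of_nat m * em_Y z U \<rho> m (Suc j) + \<rho> m (Suc (Suc j))"

text \<open>The extrapolation tableau; only the entries with \<open>1 \<le> k \<le> j\<close> are meaningful.\<close>

fun em_T :: "complex \<Rightarrow> complex \<Rightarrow> (nat \<Rightarrow> nat \<Rightarrow> complex) \<Rightarrow> nat \<Rightarrow> nat \<Rightarrow> complex" where
  "em_T z U \<rho> j k =
    (if k \<le> 1 then em_Y z U \<rho> j (2 * j)
     else em_T z U \<rho> j (k - 1) +
       (em_T z U \<rho> j (k - 1) - em_T z U \<rho> (j - 1) (k - 1)) /
         ((of_nat j)\<^sup>2 / (of_nat j - of_nat k + 1)\<^sup>2 - 1))"

declare em_T.simps [simp del]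

definition em_step :: "nat \<Rightarrow> complex \<Rightarrow> complex \<Rightarrow> (nat \<Rightarrow> nat \<Rightarrow> complex) \<Rightarrow> complex" where
  "em_step p z U \<rho> = em_T z U \<rho> (p div 2) (p div 2)"

definition em_expansion :: "nat \<Rightarrow> (complex \<Rightarrow> complex \<Rightarrow> (nat \<Rightarrow> nat \<Rightarrow> complex) \<Rightarrow> complex) \<Rightarrow>
    complex poly \<Rightarrow> (nat \<Rightarrow> nat \<Rightarrow> complex poly) \<Rightarrow> bool" where
  "em_expansion p F P Q \<longleftrightarrow>
    (\<forall>z U \<rho>. F z U \<rho> =
       poly P z * U + (\<Sum>m = 1..p div 2. \<Sum>l = 1..2 * m. poly (Q m l) z * \<rho> m l))"

text \<open>
  The internal stability polynomials. For \<open>1 \<le> m \<le> p div 2\<close> and \<open>1 \<le> l \<le> 2 * m\<close> the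
  description is proper, see \<open>ex_em_expansion\<close> and \<open>em_Q_eq\<close> below; other indices are junk.
\<close>

definition em_Q :: "nat \<Rightarrow> nat \<Rightarrow> nat \<Rightarrow> complex poly" where
  "em_Q p m l = (THE q. \<exists>P Q. em_expansion p (em_step p) P Q \<and> q = Q m l)"

text \<open>
  The supremum is taken in the extended reals, so that it is \<open>\<infinity>\<close> when a polynomial is
  unbounded on \<open>S\<close>.
\<close>

definition em_M :: "nat \<Rightarrow> complex set \<Rightarrow> ereal" where
  "em_M p S = (MAX m\<in>{1..p div 2}. MAX l\<in>{1..2 * m}. SUP z\<in>S. ereal (cmod (poly (em_Q p m l) z)))"

definition stab_region :: "nat \<Rightarrow> complex set" where
  "stab_region p = {z. cmod (\<Sum>k = 0..p. z ^ k / fact k) \<le> 1}"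

definition left_half_plane :: "complex set" where
  "left_half_plane = {z. Re z \<le> 0}"


subsection \<open>Well-definedness of the internal stability polynomials\<close>

lemma em_expansion_U: "\<exists>P Q. em_expansion p (\<lambda>z U \<rho>. U) P Q"
  by (rule exI[of _ 1], rule exI[of _ "\<lambda>_ _. 0"]) (simp add: em_expansion_def)

lemma double_sum_delta:
  fixes f :: "nat \<Rightarrow> nat \<Rightarrow> 'a::comm_ring_1"
  assumes "m \<in> {1..n}" "l \<in> {1..2 * m}"
  shows "(\<Sum>i = 1..n. \<Sum>j = 1..2 * i. f i j * (if i = m \<and> j = l then 1 else 0)) = f m l"
proof -
  have "(\<Sum>j = 1..2 * i. f i j * (if i = m \<and> j = l then 1 else 0)) = (if i = m then f m l else 0)"
    for i
  proof (cases "i = m")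
    case True
    have "(\<Sum>j = 1..2 * m. f m j * (if j = l then 1 else 0)) = (\<Sum>j = 1..2 * m. if j = l then f m j else 0)"
      by (rule sum.cong) auto
    also have "\<dots> = f m l"
      using assms(2) by (subst sum.delta) auto
    finally show ?thesis using True by simp
  qed simp
  then show ?thesis
    using assms(1) by (simp add: sum.delta)
qed

lemma em_expansion_residual:
  assumes "m \<in> {1..p div 2}" "l \<in> {1..2 * m}"
  shows "\<exists>P Q. em_expansion p (\<lambda>z U \<rho>. \<rho> m l) P Q"
proof -
  have "em_expansion p (\<lambda>z U \<rho>. \<rho> m l) 0 (\<lambda>i j. if i = m \<and> j = l then 1 else 0)"
    unfolding em_expansion_def
  proof (intro allI)
    fix z U :: complex and \<rho> :: "nat \<Rightarrow> nat \<Rightarrow> complex"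
    have "(\<Sum>i = 1..p div 2. \<Sum>j = 1..2 * i. poly (if i = m \<and> j = l then 1 else 0) z * \<rho> i j) =
          (\<Sum>i = 1..p div 2. \<Sum>j = 1..2 * i. \<rho> i j * (if i = m \<and> j = l then 1 else 0))"
      by (intro sum.cong refl) simp
    also have "\<dots> = \<rho> m l" by (rule double_sum_delta) fact+
    finally show "\<rho> m l = poly 0 z * U +
        (\<Sum>i = 1..p div 2. \<Sum>j = 1..2 * i. poly (if i = m \<and> j = l then 1 else 0) z * \<rho> i j)"
      by simp
  qed
  then show ?thesis by blast
qed

lemma em_expansion_add:
  assumes "\<exists>P Q. em_expansion p F P Q" "\<exists>P Q. em_expansion p G P Q"
  shows "\<exists>P Q. em_expansion p (\<lambda>z U \<rho>. F z U \<rho> + G z U \<rho>) P Q"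
proof -
  obtain P Q P' Q' where "em_expansion p F P Q" "em_expansion p G P' Q'"
    using assms by blast
  then have "em_expansion p (\<lambda>z U \<rho>. F z U \<rho> + G z U \<rho>) (P + P') (\<lambda>m l. Q m l + Q' m l)"
    by (simp add: em_expansion_def sum.distrib algebra_simps)
  then show ?thesis by blast
qed

lemma em_expansion_mult:
  assumes "\<exists>P Q. em_expansion p F P Q"
  shows "\<exists>P Q. em_expansion p (\<lambda>z U \<rho>. poly a z * F z U \<rho>) P Q"
proof -
  obtain P Q where "em_expansion p F P Q"
    using assms by blast
  then have "em_expansion p (\<lambda>z U \<rho>. poly a z * F z U \<rho>) (a * P) (\<lambda>m l. a * Q m l)"
    by (simp add: em_expansion_def sum_distrib_left algebra_simps)
  then show ?thesis by blast
qed

lemma em_expansion_Y: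
  assumes "m \<in> {1..p div 2}" "j \<le> 2 * m"
  shows "\<exists>P Q. em_expansion p (\<lambda>z U \<rho>. em_Y z U \<rho> m j) P Q"
  using assms(2)
proof (induction j rule: less_induct)
  case (less j)
  consider "j = 0" | "j = Suc 0" | i where "j = Suc (Suc i)"
    by (metis not0_implies_Suc)
  then show ?case
  proof cases
    case 1
    then show ?thesis by (simp add: em_expansion_U)
  next
    case 2
    have "\<exists>P Q. em_expansion p
        (\<lambda>z U \<rho>. poly [:1, 1 / (2 * of_nat m):] z * U + \<rho> m 1) P Q"
      using assms(1) by (intro em_expansion_add em_expansion_mult em_expansion_U
          em_expansion_residual) auto
    then show ?thesis using 2 by simp
  next
    case 3
    have "\<exists>P Q. em_expansion p (\<lambda>z U \<rho>. em_Y z U \<rho> m i +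
        poly [:0, 1 / of_nat m:] z * em_Y z U \<rho> m (Suc i) + \<rho> m j) P Q"
      using assms(1) less.prems 3
      by (intro em_expansion_add em_expansion_mult less.IH em_expansion_residual) auto
    then show ?thesis using 3 by simp
  qed
qed

lemma em_expansion_T:
  assumes "1 \<le> k" "k \<le> j" "j \<le> p div 2"
  shows "\<exists>P Q. em_expansion p (\<lambda>z U \<rho>. em_T z U \<rho> j k) P Q"
  using assms
proof (induction k arbitrary: j rule: less_induct)
  case (less k)
  show ?case
  proof (cases "k \<le> 1")
    case True
    then show ?thesis
      using less.prems em_expansion_Y[of j p "2 * j"] by (simp add: em_T.simps)
  next
    case False
    define c :: complex where "c = (of_nat j)\<^sup>2 / (of_nat j - of_nat k + 1)\<^sup>2 - 1"
    have "\<exists>P Q. em_expansion p (\<lambda>z U \<rho>. em_T z U \<rho> j (k - 1) +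
        (poly [:1 / c:] z * em_T z U \<rho> j (k - 1) + poly [:- 1 / c:] z * em_T z U \<rho> (j - 1) (k - 1)))
        P Q"
      using False less.prems
      by (intro em_expansion_add em_expansion_mult less.IH) auto
    moreover have "em_T z U \<rho> j (k - 1) +
        (poly [:1 / c:] z * em_T z U \<rho> j (k - 1) + poly [:- 1 / c:] z * em_T z U \<rho> (j - 1) (k - 1))
        = em_T z U \<rho> j k" for z U \<rho>
      using False em_T.simps[of z U \<rho> j k] by (simp add: c_def[symmetric] diff_divide_distrib)
    ultimately show ?thesis by simp
  qed
qed

lemma ex_em_expansion:
  assumes "2 \<le> p"
  shows "\<exists>P Q. em_expansion p (em_step p) P Q"
  using em_expansion_T[of "p div 2" "p div 2" p] assms by (simp add: em_step_def[abs_def])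

lemma em_expansion_poly_Q:
  assumes "em_expansion p F P Q" "m \<in> {1..p div 2}" "l \<in> {1..2 * m}"
  shows "poly (Q m l) z = F z 0 (\<lambda>i j. if i = m \<and> j = l then 1 else 0)"
  using assms double_sum_delta[OF assms(2,3), of "\<lambda>i j. poly (Q i j) z"]
  by (simp only: em_expansion_def mult_zero_right add_0)

lemma em_Q_eq:
  assumes "em_expansion p (em_step p) P Q" "m \<in> {1..p div 2}" "l \<in> {1..2 * m}"
  shows "em_Q p m l = Q m l"
  unfolding em_Q_def
proof (rule the_equality)
  show "\<exists>P' Q'. em_expansion p (em_step p) P' Q' \<and> Q m l = Q' m l"
    using assms(1) by blast
next
  fix q assume "\<exists>P Q. em_expansion p (em_step p) P Q \<and> q = Q m l"
  then obtain P' Q' where *: "em_expansion p (em_step p) P' Q'" "q = Q' m l" by blast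
  have "poly (Q' m l) z = poly (Q m l) z" for z
    by (simp only: em_expansion_poly_Q[OF *(1) assms(2,3)] em_expansion_poly_Q[OF assms])
  then show "q = Q m l"
    using *(2) poly_eq_poly_eq_iff by blast
qed

lemma poly_em_Q:
  assumes "m \<in> {1..p div 2}" "l \<in> {1..2 * m}"
  shows "poly (em_Q p m l) z = em_step p z 0 (\<lambda>i j. if i = m \<and> j = l then 1 else 0)"
proof -
  obtain P Q where *: "em_expansion p (em_step p) P Q"
    using ex_em_expansion[of p] assms by fastforce
  show ?thesis
    using em_expansion_poly_Q[OF * assms] em_Q_eq[OF * assms] by simp
qed

end

theory Submission
  imports Defs "HOL-Analysis.Complex_Transcendental"
begin

text \<open>
  Write \<open>p = 2 * r\<close>. The tableau is Aitken--Neville extrapolation to \<open>0\<close> in the variable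
  \<open>1 / m\<^sup>2\<close>, so its corner entry is a fixed linear combination of the values
  \<open>T\<^sub>m\<^sub>,\<^sub>1\<close>, with the Lagrange weights
  \<open>w\<^sub>m = (\<Prod>l \<noteq> m. m\<^sup>2 / (m\<^sup>2 - l\<^sup>2))\<close> (lemma \<open>em_T_eq_weighted_sum\<close>).
  A unit residual in row \<open>m\<close> reaches only \<open>T\<^sub>m\<^sub>,\<^sub>1\<close>, hence an internal stability
  polynomial is \<open>w\<^sub>m\<close> times a Fibonacci-type polynomial in \<open>z / m\<close> produced by the
  midpoint recursion. Three estimates remain.

  The growth along the recursion is at most \<open>exp (cmod z / (2 * m))\<close> per stage, hence at most
  \<open>exp (cmod z)\<close> over the \<open>2 * m\<close> stages of row \<open>m\<close> (\<open>em_Y_unit_residual_bound\<close>).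

  The weight has modulus \<open>2 * m ^ p / ((r - m)! * (r + m)!)\<close>. With
  \<open>m ^ p \<le> r ^ p * exp (2 * m - p)\<close>, with the term of index \<open>r + m\<close> in the binomial expansion of
  \<open>(exp 2 + 1) ^ p\<close>, and with \<open>p! \<ge> exp 1 * (p / exp 1) ^ p\<close>, all dependence on \<open>m\<close>
  cancels and the bound \<open>2 / exp 1 * cosh 1 ^ p\<close> results (\<open>extrapolation_weight_bound\<close>).

  In the left half-plane \<open>exp z\<close> is bounded by \<open>1\<close>, so on the stability region the Taylor
  remainder of order \<open>p\<close> has modulus at most \<open>2\<close>. The remainder is close to
  \<open>z ^ (p + 1) / (p! * (p + 1 - z))\<close>, which is too large when
  \<open>3 / 5 * p \<le> cmod z \<le> 3 * p\<close>; farther out the last Taylor term dominates all others. Hence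
  \<open>cmod z \<le> 3 / 5 * p\<close> (\<open>stab_region_left_half_plane_bound\<close>).

  Together the polynomials are bounded by
  \<open>2 / exp 1 * (cosh 1 * exp (3 / 5)) ^ p\<close>. As \<open>cosh 1 * exp (3 / 5) < 2.815\<close>, the gap between
  \<open>2.815\<close> and \<open>3.423\<close> absorbs the factor \<open>pi * sqrt (p - 1)\<close> for \<open>p \<ge> 12\<close>.
\<close>

section \<open>The tableau as Lagrange extrapolation\<close>

text \<open>
  The Lagrange basis polynomial for the node \<open>1 / i\<^sup>2\<close> among the nodes \<open>1 / l\<^sup>2\<close>,
  \<open>l \<in> A\<close>, evaluated at \<open>0\<close>.
\<close>

definition extrapolation_weight :: "nat set \<Rightarrow> nat \<Rightarrow> complex" where
  "extrapolation_weight A i = (\<Prod>l\<in>A - {i}. (of_nat i)\<^sup>2 / ((of_nat i)\<^sup>2 - (of_nat l)\<^sup>2))"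

lemma of_nat_square_eq_iff:
  "((of_nat i)\<^sup>2 = ((of_nat j)\<^sup>2 :: complex)) \<longleftrightarrow> i = j"
proof -
  have "((of_nat i)\<^sup>2 = ((of_nat j)\<^sup>2 :: complex)) \<longleftrightarrow> i\<^sup>2 = j\<^sup>2"
    by (simp only: of_nat_power [symmetric] of_nat_eq_iff)
  then show ?thesis by (simp add: power2_eq_iff_nonneg)
qed

lemma extrapolation_weight_insert:
  assumes "finite A" "j \<notin> A" "i \<noteq> j"
  shows "extrapolation_weight (insert j A) i =
    (of_nat i)\<^sup>2 / ((of_nat i)\<^sup>2 - (of_nat j)\<^sup>2) * extrapolation_weight A i"
proof -
  have "insert j A - {i} = insert j (A - {i})" using assms(3) by auto
  then show ?thesis using assms by (simp add: extrapolation_weight_def)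
qed

lemma extrapolation_weight_insert_self:
  "extrapolation_weight (insert i A) i = extrapolation_weight A i"
  by (simp add: extrapolation_weight_def)

text \<open>
  Neville's recursion for the weights: interpolation on \<open>A = B \<union> {a, b}\<close> is a combination of the
  interpolations that omit one of the end nodes. A weight at an omitted node counts as \<open>0\<close>.
\<close>

lemma extrapolation_weight_step:
  assumes "finite B" "a \<notin> B" "b \<notin> B" "a \<noteq> b" "0 < i" "i \<in> insert a (insert b B)"
  shows "((of_nat b)\<^sup>2 - (of_nat a)\<^sup>2) * extrapolation_weight (insert a (insert b B)) i =
    (of_nat b)\<^sup>2 * (if i = a then 0 else extrapolation_weight (insert b B) i) -
    (of_nat a)\<^sup>2 * (if i = b then 0 else extrapolation_weight (insert a B) i)"
proof -
  have "b \<noteq> a" "a \<notin> insert b B" "b \<notin> insert a B" using assms by auto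
  consider "i = a" | "i = b" | "i \<in> B" "i \<noteq> a" "i \<noteq> b" using assms by auto
  then show ?thesis
  proof cases
    case 1
    have "extrapolation_weight (insert a (insert b B)) a =
        (of_nat a)\<^sup>2 / ((of_nat a)\<^sup>2 - (of_nat b)\<^sup>2) * extrapolation_weight B a"
      by (simp only: extrapolation_weight_insert_self extrapolation_weight_insert[OF assms(1,3,4)])
    moreover have "(of_nat a)\<^sup>2 - (of_nat b)\<^sup>2 \<noteq> (0::complex)"
      using assms(4) by (simp add: of_nat_square_eq_iff)
    ultimately show ?thesis
      using 1 assms(4) by (simp add: extrapolation_weight_insert_self field_simps)
  next
    case 2
    have "extrapolation_weight (insert a (insert b B)) b =
        (of_nat b)\<^sup>2 / ((of_nat b)\<^sup>2 - (of_nat a)\<^sup>2) * extrapolation_weight B b"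
      by (simp only: insert_commute[of a b] extrapolation_weight_insert_self
          extrapolation_weight_insert[OF assms(1,2) \<open>b \<noteq> a\<close>])
    moreover have "(of_nat b)\<^sup>2 - (of_nat a)\<^sup>2 \<noteq> (0::complex)"
      using \<open>b \<noteq> a\<close> by (simp add: of_nat_square_eq_iff)
    ultimately show ?thesis
      using 2 assms(4) by (simp add: extrapolation_weight_insert_self field_simps)
  next
    case 3
    define u v w C :: complex where "u = (of_nat i)\<^sup>2" and "v = (of_nat a)\<^sup>2" and "w = (of_nat b)\<^sup>2"
      and "C = extrapolation_weight B i"
    have nz: "u - v \<noteq> 0" "u - w \<noteq> 0"
      using 3 by (simp_all add: u_def v_def w_def of_nat_square_eq_iff)
    have "extrapolation_weight (insert a (insert b B)) i = u / (u - v) * (u / (u - w) * C)"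
      "extrapolation_weight (insert a B) i = u / (u - v) * C"
      "extrapolation_weight (insert b B) i = u / (u - w) * C"
      using assms 3 \<open>a \<notin> insert b B\<close>
      by (simp_all add: extrapolation_weight_insert u_def v_def w_def C_def)
    moreover have "(w - v) * (u / (u - v) * (u / (u - w) * C)) =
        w * (u / (u - w) * C) - v * (u / (u - v) * C)"
      using nz by (simp add: divide_simps) (simp add: algebra_simps)
    ultimately show ?thesis using 3 by (simp add: v_def w_def)
  qed
qed

text \<open>
  The entry \<open>T\<^sub>j\<^sub>,\<^sub>k\<close> combines \<open>T\<^sub>j\<^sub>,\<^sub>k\<^sub>-\<^sub>1\<close>, which uses all its rows but the first, with
  \<open>T\<^sub>j\<^sub>-\<^sub>1\<^sub>,\<^sub>k\<^sub>-\<^sub>1\<close>, which uses all its rows but the last, with exactly the coefficients of Neville's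
  recursion for the end nodes \<open>a = j - k + 1\<close> and \<open>j\<close>.
\<close>

lemma em_T_eq_weighted_sum:
  assumes "1 \<le> k" "k \<le> j"
  shows "em_T z U \<rho> j k =
    (\<Sum>i = j - k + 1..j. extrapolation_weight {j - k + 1..j} i * em_Y z U \<rho> i (2 * i))"
  using assms
proof (induction k arbitrary: j rule: less_induct)
  case (less k)
  show ?case
  proof (cases "k = 1")
    case True
    have "extrapolation_weight {j} j = 1" by (simp add: extrapolation_weight_def)
    moreover have "j - 1 + 1 = j" using less.prems by simp
    ultimately show ?thesis
      using True by (simp add: em_T.simps)
  next
    case False
    define a where "a = j - k + 1"
    define B where "B = {a + 1..j - 1}"
    define W where "W = extrapolation_weight"
    define Y where "Y i = em_Y z U \<rho> i (2 * i)" for i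
    define u v :: complex where "u = (of_nat j)\<^sup>2" and "v = (of_nat a)\<^sup>2"
    have k: "2 \<le> k" "a < j" "1 \<le> a" "k \<le> j"
      using False less.prems by (auto simp: a_def)
    have B: "finite B" "a \<notin> B" "j \<notin> B" "a \<noteq> j"
      using k by (auto simp: B_def)
    have nodes: "{j - k + 1..j} = insert a (insert j B)" "{a + 1..j} = insert j B"
      "{a..j - 1} = insert a B"
      using k by (auto simp: B_def a_def)
    have "j - (k - 1) + 1 = a + 1" "j - 1 - (k - 1) + 1 = a"
      using k by (auto simp: a_def)
    then have T1: "em_T z U \<rho> j (k - 1) = (\<Sum>i\<in>insert j B. W (insert j B) i * Y i)"
      and T2: "em_T z U \<rho> (j - 1) (k - 1) = (\<Sum>i\<in>insert a B. W (insert a B) i * Y i)"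
      using less.IH[of "k - 1" j] less.IH[of "k - 1" "j - 1"] k nodes(2,3)
      by (simp_all add: W_def Y_def)
    have uv: "v \<noteq> 0" "u - v \<noteq> 0"
      using k by (simp_all add: u_def v_def of_nat_square_eq_iff)
    have den: "of_nat j - of_nat k + 1 = (of_nat a :: complex)"
      using k by (simp add: a_def of_nat_diff)
    have comb: "A + (A - A') / (u / v - 1) = (u * A - v * A') / (u - v)" for A A' :: complex
    proof -
      have "u / v - 1 = (u - v) / v" using uv by (simp add: field_simps)
      then show ?thesis using uv by (simp add: field_simps)
    qed
    have "em_T z U \<rho> j k = (u * em_T z U \<rho> j (k - 1) - v * em_T z U \<rho> (j - 1) (k - 1)) / (u - v)"
      using k by (subst em_T.simps) (simp only: den comb[symmetric] u_def[symmetric] v_def[symmetric], simp)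
    also have "u * em_T z U \<rho> j (k - 1) - v * em_T z U \<rho> (j - 1) (k - 1) =
        (\<Sum>i\<in>insert a (insert j B). u * ((if i = a then 0 else W (insert j B) i) * Y i)) -
        (\<Sum>i\<in>insert a (insert j B). v * ((if i = j then 0 else W (insert a B) i) * Y i))"
    proof -
      have "(\<Sum>i\<in>insert a (insert j B). u * ((if i = a then 0 else W (insert j B) i) * Y i)) =
          (\<Sum>i\<in>insert j B. u * (W (insert j B) i * Y i))"
        using B by (intro sum.mono_neutral_cong_right) auto
      moreover have "(\<Sum>i\<in>insert a (insert j B). v * ((if i = j then 0 else W (insert a B) i) * Y i)) =
          (\<Sum>i\<in>insert a B. v * (W (insert a B) i * Y i))"
        using B by (intro sum.mono_neutral_cong_right) auto
      ultimately show ?thesis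
        by (simp only: T1 T2 sum_distrib_left)
    qed
    also have "\<dots> = (\<Sum>i\<in>insert a (insert j B). (u - v) * (W (insert a (insert j B)) i * Y i))"
      unfolding sum_subtractf[symmetric]
    proof (rule sum.cong[OF refl])
      fix i assume i: "i \<in> insert a (insert j B)"
      then have "0 < i" using k by (auto simp: B_def)
      then have "(u - v) * W (insert a (insert j B)) i =
          u * (if i = a then 0 else W (insert j B) i) - v * (if i = j then 0 else W (insert a B) i)"
        using extrapolation_weight_step[OF B(1,2,3,4) _ i] by (simp only: u_def v_def W_def)
      then show "u * ((if i = a then 0 else W (insert j B) i) * Y i) -
          v * ((if i = j then 0 else W (insert a B) i) * Y i) =
          (u - v) * (W (insert a (insert j B)) i * Y i)"
        by (simp only: mult.assoc[symmetric] left_diff_distrib[symmetric])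
    qed
    finally show ?thesis
      using uv unfolding nodes(1) by (simp add: sum_distrib_left[symmetric] W_def Y_def)
  qed
qed

section \<open>The size of the extrapolation weights\<close>

lemma prod_diff_squares_below:
  assumes "n < m"
  shows "(\<Prod>l = 1..n. real m ^ 2 - real l ^ 2) = fact (m + n) / (real m * fact (m - n - 1))"
  using assms
proof (induction n)
  case 0
  then show ?case by (cases m) simp_all
next
  case (Suc n)
  obtain d where d: "m = Suc (Suc (n + d))"
    using Suc.prems by (metis less_iff_Suc_add add_Suc)
  then have sub: "m - n - 1 = Suc d" "m - Suc n - 1 = d" by simp_all
  have factor: "real m ^ 2 - real (Suc n) ^ 2 = real (Suc d) * real (Suc (m + n))"
    using d by (simp add: power2_eq_square algebra_simps)
  have "(\<Prod>l = 1..Suc n. real m ^ 2 - real l ^ 2) =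
      fact (m + n) / (real m * fact (Suc d)) * (real (Suc d) * real (Suc (m + n)))"
    using Suc by (simp only: prod.nat_ivl_Suc' factor sub) simp
  also have "\<dots> = fact (m + Suc n) / (real m * fact d)" by simp
  finally show ?case by (simp only: sub)
qed

text \<open>
  Each factor splits as \<open>m\<^sup>2 - l\<^sup>2 = (m - l) * (m + l)\<close>, so the denominators telescope to
  factorials. The induction starts at \<open>r = m\<close>, where all factors are positive; every later factor
  is negative, and only its modulus matters.
\<close>

lemma norm_extrapolation_weight:
  assumes "1 \<le> m" "m \<le> r"
  shows "cmod (extrapolation_weight {1..r} m) = 2 * real m ^ (2 * r) / (fact (r - m) * fact (r + m))"
  using assms(2)
proof (induction r rule: dec_induct)
  case base
  obtain n where n: "m = Suc n" using assms(1) by (cases m) auto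
  have "cmod (extrapolation_weight {1..m} m) =
      (\<Prod>l = 1..n. real m ^ 2 / (real m ^ 2 - real l ^ 2))"
  proof -
    have "{1..m} - {m} = {1..n}" using n by auto
    moreover have "cmod ((of_nat m)\<^sup>2 / ((of_nat m)\<^sup>2 - (of_nat l)\<^sup>2)) =
        real m ^ 2 / (real m ^ 2 - real l ^ 2)" if "l \<in> {1..n}" for l
    proof -
      have "(of_nat m)\<^sup>2 / ((of_nat m)\<^sup>2 - (of_nat l)\<^sup>2) =
          complex_of_real (real m ^ 2 / (real m ^ 2 - real l ^ 2))" by simp
      moreover have "real l ^ 2 \<le> real m ^ 2" using that n by (intro power_mono) auto
      ultimately show ?thesis by (simp only: norm_of_real) simp
    qed
    ultimately show ?thesis
      by (simp add: extrapolation_weight_def prod_norm[symmetric])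
  qed
  also have "\<dots> = (real m ^ 2) ^ n / (fact (m + n) / real m)"
    using prod_diff_squares_below[of n m] n by (simp add: prod_dividef)
  also have "\<dots> = 2 * real m ^ (2 * m) / (fact (m - m) * fact (m + m))"
  proof -
    have "real m ^ (2 * m) = (real m ^ 2) ^ Suc n" by (simp only: power_mult n)
    then have pow: "real m ^ (2 * m) = real m ^ 2 * (real m ^ 2) ^ n" by simp
    have "m + m = Suc (m + n)" using n by simp
    then have "fact (m + m) = real (Suc (m + n)) * fact (m + n)" by (simp only: fact_Suc)
    then have fac: "fact (m + m) = 2 * real m * fact (m + n)" using n by simp
    show ?thesis
      unfolding pow fac using assms(1) by (simp add: field_simps power2_eq_square)
  qed
  finally show ?case .
next
  case (step r)
  have "Suc r \<notin> {1..r}" "m \<noteq> Suc r" "{1..Suc r} = insert (Suc r) {1..r}"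
    using step.hyps by auto
  then have "extrapolation_weight {1..Suc r} m =
      (of_nat m)\<^sup>2 / ((of_nat m)\<^sup>2 - (of_nat (Suc r))\<^sup>2) * extrapolation_weight {1..r} m"
    by (simp only: extrapolation_weight_insert finite_atLeastAtMost not_False_eq_True)
  moreover have "cmod ((of_nat m)\<^sup>2 / ((of_nat m)\<^sup>2 - (of_nat (Suc r))\<^sup>2)) =
      real m ^ 2 / (real (Suc r - m) * real (Suc r + m))"
  proof -
    have "real (Suc r - m) * real (Suc r + m) = - (real m ^ 2 - real (Suc r) ^ 2)"
      using step.hyps by (simp add: of_nat_diff power2_eq_square algebra_simps)
    moreover have "(of_nat m)\<^sup>2 / ((of_nat m)\<^sup>2 - (of_nat (Suc r))\<^sup>2) =
        complex_of_real (real m ^ 2 / (real m ^ 2 - real (Suc r) ^ 2))" by simp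
    moreover have "real m ^ 2 \<le> real (Suc r) ^ 2"
      using step.hyps by (intro power_mono) auto
    ultimately show ?thesis by (simp only: norm_of_real abs_divide) simp
  qed
  moreover have "fact (Suc r - m) = real (Suc r - m) * fact (r - m)"
    using step.hyps by (simp add: Suc_diff_le)
  moreover have "fact (Suc r + m) = real (Suc r + m) * fact (r + m)" by simp
  ultimately show ?case
    by (simp only: norm_mult step.IH) (simp add: power2_eq_square mult_ac)
qed

text \<open>
  The quotient of consecutive values of \<open>n! * exp n / n ^ n\<close> is
  \<open>exp 1 / (1 + 1 / n) ^ n \<ge> 1\<close>, and the value at \<open>n = 1\<close> is \<open>exp 1\<close>.
\<close>

lemma fact_lower_bound:
  assumes "1 \<le> n"
  shows "exp 1 * real n ^ n \<le> fact n * exp (real n)"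
  using assms
proof (induction n rule: dec_induct)
  case base
  then show ?case by simp
next
  case (step n)
  have "(1 + 1 / real n) ^ n \<le> exp 1"
    using exp_ge_one_plus_x_over_n_power_n[of n 1] step.hyps by simp
  moreover have "1 + 1 / real n = real (Suc n) / real n"
    using step.hyps by (simp add: field_simps)
  ultimately have le: "real (Suc n) ^ n \<le> exp 1 * real n ^ n"
    using step.hyps by (simp only: power_divide) (simp add: field_simps)
  have "exp 1 * real (Suc n) ^ Suc n \<le> exp 1 * (real (Suc n) * (exp 1 * real n ^ n))"
    using mult_left_mono[OF le, of "real (Suc n)"] by (intro mult_left_mono) simp_all
  also have "\<dots> \<le> exp 1 * (real (Suc n) * (fact n * exp (real n)))"
    by (intro mult_left_mono step.IH) simp_all
  also have "\<dots> = fact (Suc n) * exp (real (Suc n))"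
    by (simp add: exp_add algebra_simps)
  finally show ?case .
qed

text \<open>
  The modulus equals \<open>2 * m ^ N * (N choose (r + m)) / N!\<close> with \<open>N = 2 * r\<close>. A binomial coefficient
  is bounded by a single term of \<open>(exp 2 + 1) ^ N\<close>; the base \<open>exp 2\<close> is chosen so that the factor
  \<open>exp (2 * m)\<close> lost in \<open>m / r \<le> exp (m / r - 1)\<close> is regained there. The bound so becomes
  uniform in \<open>m\<close>.
\<close>

lemma extrapolation_weight_bound:
  assumes "1 \<le> m" "m \<le> r"
  shows "cmod (extrapolation_weight {1..r} m) \<le> 2 / exp 1 * cosh 1 ^ (2 * r)"
proof -
  define N where "N = 2 * r"
  have "real m / real r \<le> exp (real m / real r - 1)"
    using exp_ge_add_one_self[of "real m / real r - 1"] by simp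
  then have "(real m / real r) ^ N \<le> exp (real m / real r - 1) ^ N"
    by (intro power_mono) simp_all
  also have "\<dots> = exp (2 * real m - real N)"
    using assms by (simp add: exp_of_nat_mult[symmetric] N_def field_simps)
  finally have m: "real m ^ N \<le> real r ^ N * exp (2 * real m - real N)"
    using assms by (simp add: power_divide field_simps)
  have "real (N choose (r + m)) * exp 2 ^ (r + m) * 1 ^ (N - (r + m)) \<le>
      (\<Sum>k\<le>N. real (N choose k) * exp 2 ^ k * 1 ^ (N - k))"
    using assms by (intro member_le_sum) (auto simp: N_def)
  moreover have "exp 2 ^ (r + m) = exp (real N + 2 * real m)"
    by (simp add: exp_of_nat_mult[symmetric] N_def algebra_simps)
  ultimately have C: "real (N choose (r + m)) * exp (real N + 2 * real m) \<le> (exp 2 + 1) ^ N"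
    by (simp add: binomial_ring)
  have f: "fact (r - m) * fact (r + m) * real (N choose (r + m)) = fact N"
  proof -
    have "N - (r + m) = r - m" "r + m \<le> N" using assms by (auto simp: N_def)
    then have "fact (r + m) * fact (r - m) * (N choose (r + m)) = fact N"
      using binomial_fact_lemma[of "r + m" N] by simp
    then have "real (fact (r + m) * fact (r - m) * (N choose (r + m))) = real (fact N)"
      by simp
    then show ?thesis by (simp add: mult_ac)
  qed
  have c0: "0 < real (N choose (r + m))" using assms by (simp add: N_def)
  have "exp 1 * real N ^ N \<le> fact N * exp (real N)"
    using assms by (intro fact_lower_bound) (simp add: N_def)
  then have fN: "exp 1 * (2 ^ N * real r ^ N) \<le> fact N * exp (real N)"
    by (simp add: N_def power_mult_distrib)
  have ch: "cosh 1 ^ N * (2 ^ N * exp (real N)) = ((exp 2 + 1) ^ N :: real)"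
  proof -
    have "cosh (1::real) * (2 * exp 1) = exp 2 + 1"
      by (simp add: cosh_def field_simps exp_minus exp_add[symmetric])
    then have "(cosh (1::real) * (2 * exp 1)) ^ N = (exp 2 + 1) ^ N" by simp
    then show ?thesis by (simp add: power_mult_distrib exp_of_nat_mult[symmetric])
  qed
  have "(exp 1 * real m ^ N * real (N choose (r + m))) * 2 ^ N * exp (real N) \<le>
      (exp 1 * (real r ^ N * exp (2 * real m - real N)) * real (N choose (r + m))) * 2 ^ N * exp (real N)"
    using m by (intro mult_right_mono mult_left_mono) simp_all
  also have "\<dots> = (exp 1 * (2 ^ N * real r ^ N)) * exp (- real N) *
      (real (N choose (r + m)) * exp (real N + 2 * real m))"
    by (simp add: exp_diff exp_add exp_minus field_simps)
  also have "\<dots> \<le> (fact N * exp (real N)) * exp (- real N) * (exp 2 + 1) ^ N"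
    by (rule mult_mono[OF mult_right_mono[OF fN] C]) simp_all
  also have "\<dots> = fact N * cosh 1 ^ N * 2 ^ N * exp (real N)"
    using ch by (simp add: exp_minus mult_ac)
  finally have "exp 1 * real m ^ N * real (N choose (r + m)) \<le> fact N * cosh 1 ^ N"
    by simp
  then have "exp 1 * real m ^ N \<le> fact (r - m) * fact (r + m) * cosh 1 ^ N"
    using c0 by (simp add: f[symmetric] mult_ac)
  then have "2 * real m ^ N / (fact (r - m) * fact (r + m)) \<le> 2 / exp 1 * cosh 1 ^ N"
    by (simp add: divide_simps mult_ac)
  then show ?thesis
    using norm_extrapolation_weight[OF assms] by (simp add: N_def)
qed

section \<open>Propagation of one residual\<close>

text \<open>
  This is \<open>t \<le> sinh t\<close> multiplied by \<open>2 * exp t\<close>. It says that \<open>exp (k * t)\<close> is a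
  supersolution of the recursion \<open>q\<^sub>k\<^sub>+\<^sub>2 = q\<^sub>k + 2 * t * q\<^sub>k\<^sub>+\<^sub>1\<close>.
\<close>

lemma exp_double_ge:
  assumes "0 \<le> (t::real)"
  shows "1 + 2 * t * exp t \<le> exp t ^ 2"
proof -
  have "1 + t + t\<^sup>2 / 2 \<le> exp t" by (rule exp_lower_Taylor_quadratic[OF assms])
  then have "1 + t\<^sup>2 / 2 \<le> exp t - t" by simp
  then have "(1 + t\<^sup>2 / 2) ^ 2 \<le> (exp t - t) ^ 2" by (intro power_mono) simp_all
  moreover have "(1 + t\<^sup>2 / 2) ^ 2 = 1 + t\<^sup>2 + (t\<^sup>2 / 2) ^ 2"
    by (simp add: power2_eq_square algebra_simps)
  moreover have "0 \<le> (t\<^sup>2 / 2) ^ 2" by simp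
  ultimately have "1 + t\<^sup>2 \<le> (exp t - t) ^ 2" by linarith
  then show ?thesis by (simp add: power2_diff algebra_simps)
qed

lemma em_Y_zero:
  assumes "\<And>i. 1 \<le> i \<Longrightarrow> i \<le> j \<Longrightarrow> \<rho> m i = 0"
  shows "em_Y z 0 \<rho> m j = 0"
  using assms by (induction z "0::complex" \<rho> m j rule: em_Y.induct) auto

text \<open>
  After the residual has entered at stage \<open>l\<close>, the values follow the homogeneous midpoint
  recursion with the starting values \<open>0\<close> and \<open>1\<close>; its coefficient \<open>z / m\<close> has modulus
  \<open>2 * t\<close> for \<open>t = cmod z / (2 * m)\<close>. The Euler starting step acts on the value \<open>0\<close> only.
\<close>

lemma em_Y_unit_residual_bound:
  fixes z :: complex and l m :: nat
  defines "\<rho> \<equiv> \<lambda>i j. if i = m \<and> j = l then 1 else (0::complex)"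
  assumes "1 \<le> l"
  shows "cmod (em_Y z 0 \<rho> m (l + k)) \<le> exp (cmod z / (2 * real m)) ^ k"
proof -
  define t where "t = cmod z / (2 * real m)"
  have t: "0 \<le> t" by (simp add: t_def)
  have before: "em_Y z 0 \<rho> m j = 0" if "j < l" for j
    using that by (intro em_Y_zero) (simp add: \<rho>_def)
  have at: "em_Y z 0 \<rho> m l = 1"
  proof -
    obtain i where i: "l = Suc i" using assms(2) by (cases l) auto
    show ?thesis
    proof (cases i)
      case 0
      then show ?thesis using i by (simp add: \<rho>_def)
    next
      case (Suc h)
      then have "em_Y z 0 \<rho> m l = \<rho> m l"
        using i before[of h] before[of i] by simp
      then show ?thesis by (simp add: \<rho>_def)
    qed
  qed
  have rec: "em_Y z 0 \<rho> m (Suc (Suc j)) = em_Y z 0 \<rho> m j + z / of_nat m * em_Y z 0 \<rho> m (Suc j)"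
    if "l < Suc (Suc j)" for j
    using that by (simp add: \<rho>_def)
  have zm: "cmod (z / of_nat m) = 2 * t" by (simp add: t_def norm_divide)
  have "cmod (em_Y z 0 \<rho> m (l + k)) \<le> exp t ^ k"
  proof (induction k rule: less_induct)
    case (less k)
    consider "k = 0" | "k = Suc 0" | i where "k = Suc (Suc i)" by (metis not0_implies_Suc)
    then show ?case
    proof cases
      case 1
      then show ?thesis by (simp add: at)
    next
      case 2
      obtain i where i: "l = Suc i" using assms(2) by (cases l) auto
      have "em_Y z 0 \<rho> m (l + k) = z / of_nat m"
        using rec[of i] before[of i] at i 2 by simp
      moreover have "2 * t \<le> exp t"
      proof -
        have "0 \<le> (t - 1)\<^sup>2" by simp
        then have "2 * t \<le> 1 + t\<^sup>2" by (simp add: power2_diff)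
        moreover have "1 + t + t\<^sup>2 / 2 \<le> exp t" by (rule exp_lower_Taylor_quadratic[OF t])
        ultimately show ?thesis using \<open>0 \<le> (t - 1)\<^sup>2\<close> by (simp add: power2_diff)
      qed
      ultimately show ?thesis using 2 zm by simp
    next
      case 3
      have "em_Y z 0 \<rho> m (l + k) =
          em_Y z 0 \<rho> m (l + i) + z / of_nat m * em_Y z 0 \<rho> m (l + Suc i)"
        using rec[of "l + i"] 3 by simp
      also have "cmod \<dots> \<le> cmod (em_Y z 0 \<rho> m (l + i)) + 2 * t * cmod (em_Y z 0 \<rho> m (l + Suc i))"
        by (rule order_trans[OF norm_triangle_ineq]) (simp only: norm_mult zm order_refl)
      also have "\<dots> \<le> exp t ^ i + 2 * t * exp t ^ Suc i"
        using 3 t by (intro add_mono mult_left_mono less.IH) auto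
      also have "\<dots> = exp t ^ i * (1 + 2 * t * exp t)" by (simp add: algebra_simps)
      also have "\<dots> \<le> exp t ^ i * exp t ^ 2"
        by (intro mult_left_mono exp_double_ge t) simp
      also have "\<dots> = exp t ^ k" using 3 by (simp add: power2_eq_square)
      finally show ?thesis .
    qed
  qed
  then show ?thesis by (simp add: t_def)
qed

lemma em_Q_bound:
  assumes "m \<in> {1..p div 2}" "l \<in> {1..2 * m}" "even p"
  shows "cmod (poly (em_Q p m l) z) \<le> 2 / exp 1 * cosh 1 ^ p * exp (cmod z)"
proof -
  define r where "r = p div 2"
  define \<rho> where "\<rho> = (\<lambda>i j. if i = m \<and> j = l then 1 else (0::complex))"
  have m: "1 \<le> m" "m \<le> r" and l: "1 \<le> l" "l \<le> 2 * m" using assms by (auto simp: r_def)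
  have p: "p = 2 * r" using assms(3) by (simp add: r_def)
  have "poly (em_Q p m l) z = em_T z 0 \<rho> r r"
    using poly_em_Q[OF assms(1,2)] by (simp add: em_step_def \<rho>_def r_def)
  also have "\<dots> = (\<Sum>i = 1..r. extrapolation_weight {1..r} i * em_Y z 0 \<rho> i (2 * i))"
    using em_T_eq_weighted_sum[of r r] m by simp
  also have "\<dots> = (\<Sum>i\<in>{m}. extrapolation_weight {1..r} i * em_Y z 0 \<rho> i (2 * i))"
    using m em_Y_zero[of _ \<rho>] by (intro sum.mono_neutral_right) (auto simp: \<rho>_def)
  finally have Q: "poly (em_Q p m l) z = extrapolation_weight {1..r} m * em_Y z 0 \<rho> m (2 * m)"
    by simp
  have "cmod (em_Y z 0 \<rho> m (l + (2 * m - l))) \<le> exp (cmod z / (2 * real m)) ^ (2 * m - l)"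
    unfolding \<rho>_def by (rule em_Y_unit_residual_bound[OF l(1)])
  also have "\<dots> \<le> exp (cmod z / (2 * real m)) ^ (2 * m)"
    by (intro power_increasing) simp_all
  also have "\<dots> = exp (cmod z)"
    using m by (simp add: exp_of_nat_mult[symmetric])
  finally have "cmod (em_Y z 0 \<rho> m (2 * m)) \<le> exp (cmod z)" using l by simp
  then show ?thesis
    using extrapolation_weight_bound[OF m] unfolding Q norm_mult p[symmetric]
    by (intro mult_mono) simp_all
qed

section \<open>The stability region in the left half-plane\<close>

definition exp_taylor :: "nat \<Rightarrow> complex \<Rightarrow> complex" where
  "exp_taylor n z = (\<Sum>k\<le>n. z ^ k / fact k)"

text \<open>
  The curve runs from \<open>exp_taylor n z\<close> at \<open>t = 0\<close> to \<open>exp z\<close> at \<open>t = 1\<close>. Its derivative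
  telescopes to a single term, which is the integrand of the integral form of the Taylor remainder.
\<close>

lemma exp_taylor_has_derivative:
  "((\<lambda>t. exp (of_real t * z) * exp_taylor n (of_real (1 - t) * z)) has_vector_derivative
     exp (of_real t * z) * z * (of_real (1 - t) * z) ^ n / fact n) (at t)"
proof (induction n)
  case 0
  show ?case
    unfolding exp_taylor_def
    by (auto intro!: derivative_eq_intros has_vector_derivative_real_field simp: mult_ac)
next
  case (Suc n)
  define w where "w = of_real (1 - t) * z"
  have E: "((\<lambda>t. exp (of_real t * z)) has_vector_derivative z * exp (of_real t * z)) (at t)"
    by (auto intro!: derivative_eq_intros has_vector_derivative_real_field simp: mult_ac)
  have W: "((\<lambda>t. (of_real (1 - t) * z) ^ Suc n / fact (Suc n)) has_vector_derivative
      - z * w ^ n / fact n) (at t)"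
  proof -
    have "((\<lambda>u. (1 - u) * z) has_field_derivative - z) (at (of_real t))"
      by (auto intro!: derivative_eq_intros)
    note DERIV_cdivide[OF DERIV_power[OF this, of "Suc n"], of "fact (Suc n)"]
    moreover have "of_nat (Suc n) * (- z * ((1 - of_real t) * z) ^ (Suc n - Suc 0)) / fact (Suc n) =
        - z * w ^ n / fact n"
      by (simp add: w_def del: of_nat_Suc)
    ultimately show ?thesis
      using has_vector_derivative_real_field[of "\<lambda>u. ((1 - u) * z) ^ Suc n / fact (Suc n)"]
      by (simp only: of_real_diff of_real_1)
  qed
  have eq: "exp (of_real s * z) * exp_taylor (Suc n) (of_real (1 - s) * z) =
      exp (of_real s * z) * exp_taylor n (of_real (1 - s) * z) +
      exp (of_real s * z) * ((of_real (1 - s) * z) ^ Suc n / fact (Suc n))" for s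
    by (simp add: exp_taylor_def distrib_left)
  have "((\<lambda>s. exp (of_real s * z) * exp_taylor (Suc n) (of_real (1 - s) * z)) has_vector_derivative
      exp (of_real t * z) * z * w ^ n / fact n +
      (exp (of_real t * z) * (- z * w ^ n / fact n) + z * exp (of_real t * z) * (w ^ Suc n / fact (Suc n)))) (at t)"
    unfolding eq w_def
    by (intro has_vector_derivative_add Suc.IH has_vector_derivative_mult E W[unfolded w_def])
  moreover have "exp (of_real t * z) * z * w ^ n / fact n +
      (exp (of_real t * z) * (- z * w ^ n / fact n) + z * exp (of_real t * z) * (w ^ Suc n / fact (Suc n))) =
      exp (of_real t * z) * z * w ^ Suc n / fact (Suc n)"
    by (simp add: mult_ac)
  ultimately show ?case by (simp only: w_def)
qed

text \<open>
  Up to the stated error, the remainder is \<open>z ^ (n + 1) / (n! * (n + 1 - z))\<close>. Writing it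
  as \<open>z ^ (n + 1) / n! * I\<close> with \<open>I = \<integral>\<^sub>0\<^sup>1 (1 - t) ^ n * exp (t * z) dt\<close>, integration by parts gives
  \<open>1 - (n + 1 - z) * I = z * \<integral>\<^sub>0\<^sup>1 t * (1 - t) ^ n * exp (t * z) dt\<close>. In the left half-plane
  the exponential has modulus at most \<open>1\<close>, which leaves the Beta integral
  \<open>1 / ((n + 1) * (n + 2))\<close>. The factor \<open>n + 1 - z\<close> is essential: it keeps the relative
  error of order \<open>cmod z / n\<^sup>2\<close>, hence small even where \<open>cmod z\<close> is a multiple of \<open>n\<close>.

  The proof compares increments over \<open>[0, 1]\<close> instead of integrals. The curve \<open>G\<close> has the last
  integrand, times \<open>z ^ (n + 2) / n!\<close>, as its derivative, and \<open>\<phi>\<close> is a primitive of the bound of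
  its modulus.
\<close>

lemma exp_taylor_remainder:
  assumes "Re z \<le> 0"
  shows "cmod (z ^ Suc n / fact n - (of_nat (Suc n) - z) * (exp z - exp_taylor n z)) \<le>
    cmod z ^ (n + 2) / (fact n * (real n + 1) * (real n + 2))"
proof -
  define H where "H k t = exp (of_real t * z) * exp_taylor k (of_real (1 - t) * z)" for k t
  define H' where "H' k t = exp (of_real t * z) * z * (of_real (1 - t) * z) ^ k / fact k" for k t
  define c where "c = cmod z ^ (n + 2) / fact n"
  define G where "G t = z * H n t - of_nat (Suc n) * H (Suc n) t" for t
  define \<phi> where "\<phi> t = c * ((1 - t) ^ Suc (Suc n) / real (Suc (Suc n)) - (1 - t) ^ Suc n / real (Suc n))"
    for t :: real
  have c: "0 \<le> c" by (simp add: c_def)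
  have H: "(H k has_vector_derivative H' k t) (at t)" for k t
    unfolding H_def[abs_def] H'_def by (rule exp_taylor_has_derivative)
  have G: "(G has_vector_derivative z * H' n t - of_nat (Suc n) * H' (Suc n) t) (at t)" for t
    unfolding G_def[abs_def]
    by (intro has_vector_derivative_diff has_vector_derivative_mult_right H)
  have D: "((\<lambda>t. (1 - t) ^ Suc k / real (Suc k)) has_field_derivative - ((1 - t) ^ k)) (at t)"
    for k and t :: real
  proof -
    have "((\<lambda>t. 1 - t) has_field_derivative - 1) (at t)"
      by (auto intro!: derivative_eq_intros)
    from DERIV_cdivide[OF DERIV_power[OF this, of "Suc k"], of "real (Suc k)"]
    show ?thesis by (simp del: of_nat_Suc power_Suc)
  qed
  have \<phi>: "(\<phi> has_vector_derivative c * (t * (1 - t) ^ n)) (at t)" for t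
  proof -
    have "(\<phi> has_field_derivative c * (- ((1 - t) ^ Suc n) - - ((1 - t) ^ n))) (at t)"
      unfolding \<phi>_def[abs_def] by (intro DERIV_cmult DERIV_diff D)
    moreover have "- ((1 - t) ^ Suc n) - - ((1 - t) ^ n) = t * (1 - t) ^ n"
      by (simp add: algebra_simps)
    ultimately show ?thesis
      by (simp only: has_real_derivative_iff_has_vector_derivative)
  qed
  have bound: "cmod (z * H' n t - of_nat (Suc n) * H' (Suc n) t) \<le> c * (t * (1 - t) ^ n)"
    if "0 < t" "t < 1" for t
  proof -
    have "of_nat (Suc n) * H' (Suc n) t = exp (of_real t * z) * z * (of_real (1 - t) * z) ^ Suc n / fact n"
      by (simp add: H'_def del: of_nat_Suc)
    then have "z * H' n t - of_nat (Suc n) * H' (Suc n) t =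
        exp (of_real t * z) * z\<^sup>2 * (of_real (1 - t) * z) ^ n * of_real t / fact n"
      by (simp add: H'_def field_simps power2_eq_square)
    then have "cmod (z * H' n t - of_nat (Suc n) * H' (Suc n) t) = exp (t * Re z) * (c * (t * (1 - t) ^ n))"
      using that by (simp add: norm_mult norm_divide norm_power c_def power_mult_distrib power_add
          power2_eq_square mult_ac del: of_real_diff)
    moreover have "exp (t * Re z) \<le> 1"
      using assms that by (simp add: mult_nonneg_nonpos)
    moreover have "0 \<le> c * (t * (1 - t) ^ n)" using c that by simp
    ultimately show ?thesis by (simp add: mult_left_le_one_le)
  qed
  have cont: "continuous_on {0..1} G" "continuous_on {0..1} \<phi>"
    using G \<phi> by (auto intro!: continuous_at_imp_continuous_on has_vector_derivative_continuous)
  have "cmod (G 1 - G 0) \<le> \<phi> 1 - \<phi> 0"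
    using G \<phi> bound
    by (intro differentiable_bound_general[OF zero_less_one cont, where f' = "\<lambda>t. z * H' n t - of_nat (Suc n) * H' (Suc n) t"
          and \<phi>' = "\<lambda>t. c * (t * (1 - t) ^ n)"]) auto
  moreover have "G 1 - G 0 = z ^ Suc n / fact n - (of_nat (Suc n) - z) * (exp z - exp_taylor n z)"
  proof -
    have s0: "exp_taylor k 0 = 1" for k
      by (simp add: exp_taylor_def power_0_left if_distrib[where f = "\<lambda>x. x / _"] sum.delta cong: if_cong)
    have s1: "of_nat (Suc n) * exp_taylor (Suc n) z = of_nat (Suc n) * exp_taylor n z + z ^ Suc n / fact n"
      by (simp add: exp_taylor_def distrib_left del: of_nat_Suc power_Suc)
    have "G 1 - G 0 = (z - of_nat (Suc n)) * exp z - z * exp_taylor n z + of_nat (Suc n) * exp_taylor (Suc n) z"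
      by (simp add: G_def H_def s0 algebra_simps)
    then show ?thesis unfolding s1 by (simp add: algebra_simps)
  qed
  moreover have "\<phi> 1 - \<phi> 0 = c / ((real n + 1) * (real n + 2))"
    by (simp add: \<phi>_def field_simps)
  ultimately show ?thesis by (simp add: c_def mult.assoc)
qed

text \<open>
  By Bernoulli's inequality, raising \<open>p\<close> by one multiplies \<open>(3 / 5 * p) ^ p / p!\<close> by at least
  \<open>3 / 5 * 2 > 1\<close>, so the value at \<open>p = 12\<close>, which is slightly above \<open>40\<close>, is decisive.
\<close>

lemma scaled_power_over_fact:
  assumes "12 \<le> p"
  shows "40 * fact p \<le> (3 / 5 * real p) ^ p"
  using assms
proof (induction p rule: dec_induct)
  case base
  show ?case by (simp add: fact_numeral power_divide)
next
  case (step p)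
  define x where "x = 3 / 5 * real p"
  define y where "y = 3 / 5 * real (Suc p)"
  have x: "0 < x" using step.hyps by (simp add: x_def)
  have yx: "y / x = 1 + 1 / real p"
    using step.hyps by (simp add: x_def y_def field_simps)
  have "1 + real p * (1 / real p) \<le> (1 + 1 / real p) ^ p"
    by (rule Bernoulli_inequality) (rule order_trans[of _ 0], simp_all)
  then have "2 \<le> (y / x) ^ p" using step.hyps by (simp add: yx)
  then have "2 * x ^ p \<le> y ^ p" using x by (simp add: power_divide field_simps)
  then have "2 * (40 * fact p) \<le> y ^ p"
    using step.IH unfolding x_def by linarith
  then have "y * (2 * (40 * fact p)) \<le> y ^ Suc p"
    unfolding power_Suc by (rule mult_left_mono) (simp add: y_def)
  moreover have "40 * fact (Suc p) \<le> y * (2 * (40 * fact p))"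
    by (simp add: y_def field_simps)
  ultimately show ?case unfolding y_def by (rule order_trans[rotated])
qed

text \<open>
  Up to index \<open>n\<close> the terms grow at least by the factor \<open>3\<close>, so the lower ones are dominated by
  the geometric series \<open>1 / 3 + 1 / 9 + \<dots> = 1 / 2\<close>.
\<close>

lemma exp_taylor_lower_terms:
  assumes "3 * real n \<le> x"
  shows "(\<Sum>k<n. x ^ k / fact k) \<le> x ^ n / fact n / 2"
  using assms
proof (induction n)
  case 0
  then show ?case by simp
next
  case (Suc n)
  have "(\<Sum>k<Suc n. x ^ k / fact k) \<le> 3 * (x ^ n / fact n) / 2"
    using Suc by simp
  also have "\<dots> \<le> (x / real (Suc n)) * (x ^ n / fact n) / 2"
    using Suc.prems by (intro divide_right_mono mult_right_mono) (simp_all add: field_simps)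
  also have "\<dots> = x ^ Suc n / fact (Suc n) / 2" by (simp add: field_simps)
  finally show ?case .
qed

lemma exp_taylor_large_if_far:
  assumes "12 \<le> p" "3 * real p \<le> cmod z"
  shows "1 < cmod (exp_taylor p z)"
proof -
  define x where "x = cmod z"
  have "(3 / 5 * real p) ^ p \<le> x ^ p"
    using assms by (intro power_mono) (simp_all add: x_def)
  then have "40 * fact p \<le> x ^ p"
    using scaled_power_over_fact[OF assms(1)] by linarith
  then have "40 \<le> x ^ p / fact p" by (simp add: field_simps)
  moreover have "cmod (\<Sum>k<p. z ^ k / fact k) \<le> x ^ p / fact p / 2"
    using exp_taylor_lower_terms[of p x] assms(2)
    by (intro order_trans[OF norm_sum]) (simp add: x_def norm_divide norm_power)
  moreover have "exp_taylor p z = (\<Sum>k<p. z ^ k / fact k) + z ^ p / fact p"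
    by (simp add: exp_taylor_def lessThan_Suc_atMost[symmetric])
  moreover have "cmod (z ^ p / fact p) = x ^ p / fact p"
    by (simp add: x_def norm_divide norm_power)
  ultimately show ?thesis
    using norm_diff_ineq[of "z ^ p / fact p" "\<Sum>k<p. z ^ k / fact k"] by (simp add: add.commute)
qed

text \<open>
  Here the error in the approximation of the remainder \<open>R\<close> is at most a quarter of the main term,
  because \<open>cmod z \<le> 3 * p\<close> and \<open>(p + 1) * (p + 2) \<ge> 12 * p\<close>. This forces \<open>cmod R > 2\<close>,
  whereas \<open>exp z\<close> has modulus at most \<open>1\<close>.
\<close>

lemma exp_taylor_large_in_annulus:
  assumes "12 \<le> p" "Re z \<le> 0" "3 / 5 * real p \<le> cmod z" "cmod z \<le> 3 * real p"
  shows "1 < cmod (exp_taylor p z)"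
proof -
  define x where "x = cmod z"
  define R where "R = exp z - exp_taylor p z"
  define A where "A = x ^ p / fact p"
  have p: "12 \<le> real p" using assms(1) by simp
  have x: "3 / 5 * real p \<le> x" "x \<le> 3 * real p" "0 < x" using assms by (auto simp: x_def)
  have "(3 / 5 * real p) ^ p \<le> x ^ p" using x by (intro power_mono) simp_all
  then have "40 * fact p \<le> x ^ p"
    using scaled_power_over_fact[OF assms(1)] by linarith
  then have A: "40 \<le> A" by (simp add: A_def field_simps)
  have rem: "cmod (z ^ Suc p / fact p - (of_nat (Suc p) - z) * R) \<le>
      x ^ (p + 2) / (fact p * (real p + 1) * (real p + 2))"
    unfolding R_def x_def by (rule exp_taylor_remainder[OF assms(2)])
  have "x ^ (p + 2) / (fact p * (real p + 1) * (real p + 2)) = A * x * (x / ((real p + 1) * (real p + 2)))"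
    by (simp add: A_def power_add power2_eq_square field_simps)
  also have "\<dots> \<le> A * x * (1 / 4)"
  proof -
    have "12 * real p \<le> (real p + 1) * (real p + 2)"
      using mult_right_mono[OF p of_nat_0_le_iff[of p]] by (simp add: algebra_simps)
    then have "x / ((real p + 1) * (real p + 2)) \<le> 1 / 4"
      using x p by (simp add: divide_le_eq)
    then show ?thesis using A x by (intro mult_left_mono) simp_all
  qed
  finally have small: "cmod (z ^ Suc p / fact p - (of_nat (Suc p) - z) * R) \<le> A * x * (1 / 4)"
    by (rule order_trans[OF rem])
  have "cmod (z ^ Suc p / fact p) = A * x"
    by (simp add: A_def x_def norm_divide norm_mult norm_power)
  then have "A * x * (3 / 4) \<le> cmod ((of_nat (Suc p) - z) * R)"
    using small norm_triangle_ineq2[of "z ^ Suc p / fact p" "(of_nat (Suc p) - z) * R"] by simp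
  also have "\<dots> \<le> (real p + 1 + x) * cmod R"
  proof -
    have "cmod (of_nat (Suc p)) = real p + 1" by (subst norm_of_nat) simp
    then have "cmod (of_nat (Suc p) - z) \<le> real p + 1 + x"
      using norm_triangle_ineq4[of "of_nat (Suc p)" z] by (simp only: x_def)
    then show ?thesis unfolding norm_mult by (rule mult_right_mono) simp
  qed
  finally have R: "A * x * (3 / 4) \<le> (real p + 1 + x) * cmod R" .
  have "2 < cmod R"
  proof (rule ccontr)
    assume "\<not> 2 < cmod R"
    then have "(real p + 1 + x) * cmod R \<le> (real p + 1 + x) * 2"
      using x by (intro mult_left_mono) simp_all
    moreover have "30 * x \<le> A * x * (3 / 4)" using A x by simp
    \<comment> \<open>Now \<open>28 * x \<le> 2 * (p + 1)\<close>, which contradicts \<open>x \<ge> 3 / 5 * p\<close>.\<close>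
    ultimately show False using R x p by simp
  qed
  moreover have "cmod (exp z) \<le> 1" using assms(2) by simp
  ultimately show ?thesis
    using norm_triangle_ineq4[of "exp z" "exp_taylor p z"] unfolding R_def by linarith
qed

lemma stab_region_left_half_plane_bound:
  assumes "12 \<le> p" "z \<in> stab_region p \<inter> left_half_plane"
  shows "cmod z \<le> 3 / 5 * real p"
proof (rule ccontr)
  assume "\<not> cmod z \<le> 3 / 5 * real p"
  moreover have "cmod (exp_taylor p z) \<le> 1" "Re z \<le> 0"
    using assms(2) by (simp_all add: stab_region_def left_half_plane_def exp_taylor_def atLeast0AtMost)
  ultimately show False
    using exp_taylor_large_if_far[OF assms(1), of z] exp_taylor_large_in_annulus[OF assms(1), of z]
    by linarith
qed

section \<open>Comparison of constants\<close>

lemma cosh_1_exp_bound: "cosh 1 * exp (3 / 5) \<le> (2.815::real)"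
proof -
  have e: "exp 1 \<le> (2.72::real)" "(2.718::real) \<le> exp 1"
    using e_less_272 abs_le_D2[OF e_approx_32] by simp_all
  have "exp (-1) \<le> 1 / (2.718::real)"
    using e by (simp add: exp_minus field_simps)
  then have c: "cosh 1 \<le> (1.544::real)" using e by (simp add: cosh_def)
  \<comment> \<open>The fifth power reduces the estimate of \<open>exp (3 / 5)\<close> to that of \<open>exp 1\<close>.\<close>
  have "exp (3 / 5) ^ 5 = exp (1::real) ^ 3"
    by (simp add: exp_of_nat_mult[symmetric])
  also have "\<dots> \<le> 2.72 ^ 3" using e by (intro power_mono) simp_all
  also have "\<dots> \<le> 1.823 ^ 5" by (simp add: power_divide)
  finally have "exp (3 / 5) \<le> (1.823::real)"
    by (rule power_le_imp_le_base[of _ 4, simplified]) simp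
  then have "cosh 1 * exp (3 / 5) \<le> 1.544 * (1.823::real)"
    using c by (intro mult_mono) simp_all
  then show ?thesis by simp
qed

text \<open>
  The square of the comparison to be made. The factor \<open>8\<close> exceeds the square of \<open>5 / 2\<close>, which in
  turn exceeds the constant \<open>2 / exp 1 * pi\<close>.
\<close>

lemma exponential_beats_linear:
  assumes "12 \<le> p"
  shows "8 * (real p - 1) < (3.423 / 2.815) ^ (2 * p)"
  using assms
proof (induction p rule: dec_induct)
  case base
  show ?case by (simp add: power_divide)
next
  case (step p)
  have "8 * (real (Suc p) - 1) \<le> 1.4 * (8 * (real p - 1))"
    using step.hyps by simp
  also have "\<dots> < 1.4 * (3.423 / 2.815) ^ (2 * p)" using step.IH by simp
  also have "\<dots> \<le> (3.423 / 2.815) ^ 2 * (3.423 / 2.815) ^ (2 * p)"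
    by (intro mult_right_mono) (simp_all add: power_divide)
  also have "\<dots> = (3.423 / 2.815) ^ (2 * Suc p)" by (simp only: power_add[symmetric]) simp
  finally show ?case .
qed

lemma final_constant_bound:
  assumes "12 \<le> p"
  shows "2 / exp 1 * cosh 1 ^ p * exp (3 / 5 * real p) < 3.423 ^ p / (pi * sqrt (real p - 1))"
proof -
  define s where "s = sqrt (real p - 1)"
  have s: "0 < s" "s\<^sup>2 = real p - 1" using assms by (simp_all add: s_def)
  have "(5 / 2 * s)\<^sup>2 \<le> 8 * (real p - 1)" using s assms by (simp add: power_mult_distrib power_divide)
  also have "\<dots> < ((3.423 / 2.815) ^ p)\<^sup>2"
    using exponential_beats_linear[OF assms] by (simp only: power_even_eq)
  finally have "5 / 2 * s < (3.423 / 2.815) ^ p"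
    by (rule power_less_imp_less_base) simp
  then have "5 / 2 * s < 3.423 ^ p / 2.815 ^ p" by (simp only: power_divide)
  then have main: "5 / 2 * s * 2.815 ^ p < 3.423 ^ p"
    by (subst (asm) pos_less_divide_eq) simp_all
  have e: "(2.718::real) \<le> exp 1" using abs_le_D2[OF e_approx_32] by simp
  then have pe: "2 / exp 1 * pi \<le> 5 / 2"
    using pi_approx(2) by (simp add: field_simps)
  have "cosh 1 ^ p * exp (3 / 5 * real p) = (cosh 1 * exp (3 / 5)) ^ p"
    by (simp add: power_mult_distrib exp_of_nat_mult[symmetric] mult.commute)
  also have "\<dots> \<le> 2.815 ^ p" by (intro power_mono cosh_1_exp_bound) simp
  finally have "(2 / exp 1 * pi) * s * (cosh 1 ^ p * exp (3 / 5 * real p)) \<le> 5 / 2 * s * 2.815 ^ p"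
    using pe s by (intro mult_mono) simp_all
  also note main
  finally have "2 / exp 1 * cosh 1 ^ p * exp (3 / 5 * real p) * (pi * s) < 3.423 ^ p"
    by (simp only: mult_ac)
  then show ?thesis
    unfolding s_def[symmetric] using s by (subst pos_less_divide_eq) simp_all
qed

theorem theorem4p23:
  fixes p :: nat
  assumes "even p" and "p \<ge> 12"
  shows "em_M p (stab_region p \<inter> left_half_plane)
           < ereal (3.423 ^ p / (pi * sqrt (real p - 1)))"
proof -
  define B where "B = 2 / exp 1 * cosh 1 ^ p * exp (3 / 5 * real p)"
  have Q: "cmod (poly (em_Q p m l) z) \<le> B"
    if "m \<in> {1..p div 2}" "l \<in> {1..2 * m}" "z \<in> stab_region p \<inter> left_half_plane" for m l z
  proof -
    have "cmod (poly (em_Q p m l) z) \<le> 2 / exp 1 * cosh 1 ^ p * exp (cmod z)"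
      by (rule em_Q_bound[OF that(1,2) assms(1)])
    also have "\<dots> \<le> B"
      unfolding B_def using stab_region_left_half_plane_bound[OF assms(2) that(3)]
      by (intro mult_left_mono) simp_all
    finally show ?thesis .
  qed
  have "em_M p (stab_region p \<inter> left_half_plane) \<le> ereal B"
    unfolding em_M_def using assms(2) Q
    by (auto intro!: Max.boundedI SUP_least)
  also have "\<dots> < ereal (3.423 ^ p / (pi * sqrt (real p - 1)))"
    using final_constant_bound[OF assms(2)] by (simp add: B_def)
  finally show ?thesis .
qed

end
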